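(* For any $\alpha>0$ there exist $\beta>0$ and $c>0$ such that for every integer $n>0$ there exists a filtration $\{\mathcal{F}_i\}_{i\ge0}$ on some probability space and an $\mathcal{F}_i$-adapted discrete time real-valued martingale $\{M_i\}_{i\ge 0}$ satisfying, for all $i\ge 0$, almost surely, $|M_{i+1}-M_i|\le 1$ and $P(|M_{i+1}-M_i|=1\mid\mathcal{F}_i)>\beta$, such that $$P(|M_n|\le 1)\ge c\,n^{-\alpha}.$$ *)

theory Defs
  imports "HOL-Probability.Probability"
begin

definition filtration_on :: "'a measure \<Rightarrow> (nat \<Rightarrow> 'a measure) \<Rightarrow> bool" where
  "filtration_on P F \<longleftrightarrow> filtration (space P) F \<and> (\<forall>i. subalgebra P (F i))"

(* Only one-step increments are constrained; for integer time, the tower property extends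
   the identity to all i <= j. The values of the measures F i are irrelevant: only their
   sigma-algebras matter. When existence "on some probability space" is asserted for real
   processes, it is enough to allow sample points of type nat => real: the law of a process on
   path space, with its natural filtration, inherits the martingale property and almost sure
   lower bounds on conditional probabilities of events determined by the process. *)
definition martingale :: "'a measure \<Rightarrow> (nat \<Rightarrow> 'a measure) \<Rightarrow> (nat \<Rightarrow> 'a \<Rightarrow> real) \<Rightarrow> bool" where
  "martingale P F M \<longleftrightarrow>
     filtration_on P F \<and>
     (\<forall>i. M i \<in> borel_measurable (F i)) \<and>
     (\<forall>i. integrable P (M i)) \<and>
     (\<forall>i. AE \<omega> in P. real_cond_exp P (F i) (M (Suc i)) \<omega> = M i \<omega>)"

definition cond_prob_given ::
  "'a measure \<Rightarrow> 'a measure \<Rightarrow> 'a set \<Rightarrow> 'a \<Rightarrow> real" where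
  "cond_prob_given P G A = real_cond_exp P G (indicator A)"

end

theory Submission
  imports Defs
begin

text \<open>
  The martingale walks on the integers. With \<open>k\<close> steps left it makes either a simple random walk
  step or a lazy one, moving only with probability \<open>e\<close>, whichever gives the better chance of
  ending in \<open>[-1, 1]\<close>. A lower bound for this optimal chance comes from a multiscale strategy.
  From \<open>\<bar>x\<bar> \<le> 2 ^ Suc j\<close>, run the simple walk until it hits \<open>0\<close>, then stay lazy; after
  \<open>D\<^sup>2 * 4 ^ j\<close> steps in all, the position is within \<open>2 ^ j\<close> of the origin except with probability
  \<open>5 / D\<close>, if \<open>e = 1 / D ^ 3\<close>. About \<open>log 4 n\<close> such scales fit into \<open>n\<close> steps, so the chance is at
  least of order \<open>(1 - 5 / D)\<close> to the power \<open>log 4 n\<close>, which is at least \<open>n powr (- \<alpha>)\<close> once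
  \<open>4 powr (- \<alpha>) \<le> 1 - 5 / D\<close>.
\<close>

section \<open>Value function of the control problem\<close>

definition walk_avg :: "(real \<Rightarrow> real) \<Rightarrow> real \<Rightarrow> real" where
  "walk_avg f x = (f (x + 1) + f (x - 1)) / 2"

definition lazy_avg :: "real \<Rightarrow> (real \<Rightarrow> real) \<Rightarrow> real \<Rightarrow> real" where
  "lazy_avg e f x = (1 - e) * f x + e * walk_avg f x"

text \<open>The optimal probability of ending in \<open>[-1, 1]\<close> with \<open>k\<close> steps left, starting from \<open>x\<close>.\<close>
primrec hit_value :: "real \<Rightarrow> nat \<Rightarrow> real \<Rightarrow> real" where
  "hit_value e 0 = indicator {x. \<bar>x\<bar> \<le> 1}"
| "hit_value e (Suc k) = (\<lambda>x. max (walk_avg (hit_value e k) x) (lazy_avg e (hit_value e k) x))"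

text \<open>Only the neighbours of \<open>x\<close> are compared, because the later inductions know
  the inequality just on an interval or at integers.\<close>

lemma walk_avg_mono:
  assumes "f (x + 1) \<le> g (x + 1)" "f (x - 1) \<le> g (x - 1)"
  shows "walk_avg f x \<le> walk_avg g x"
  using assms by (simp add: walk_avg_def add_mono)

lemma lazy_avg_mono:
  assumes "0 \<le> e" "e \<le> 1" "f x \<le> g x" "f (x + 1) \<le> g (x + 1)" "f (x - 1) \<le> g (x - 1)"
  shows "lazy_avg e f x \<le> lazy_avg e g x"
  unfolding lazy_avg_def by (intro add_mono mult_left_mono walk_avg_mono) (use assms in auto)

lemma hit_value_ge_0: "0 \<le> hit_value e k x"
proof (induction k arbitrary: x)
  case (Suc k)
  then have "0 \<le> walk_avg (hit_value e k) x" by (simp add: walk_avg_def)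
  then show ?case by simp
qed simp

lemma hit_value_le_1:
  assumes "0 \<le> e" "e \<le> 1"
  shows "hit_value e k x \<le> 1"
proof (induction k arbitrary: x)
  case (Suc k)
  have "walk_avg (hit_value e k) x \<le> walk_avg (\<lambda>_. 1) x"
    "lazy_avg e (hit_value e k) x \<le> lazy_avg e (\<lambda>_. 1) x"
    by (intro walk_avg_mono lazy_avg_mono assms Suc)+
  then show ?case by (simp add: walk_avg_def lazy_avg_def)
qed (simp add: indicator_def)

text \<open>Both kinds of step and the target are symmetric; this reduces the return to
  \<open>0\<close> to starting points in the naturals.\<close>

lemma hit_value_uminus: "hit_value e k (- x) = hit_value e k x"
proof (induction k arbitrary: x)
  case (Suc k)
  have "hit_value e k (- x + 1) = hit_value e k (x - 1)"
    "hit_value e k (- x - 1) = hit_value e k (x + 1)"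
    using Suc[of "x - 1"] Suc[of "x + 1"] by simp_all
  then show ?case using Suc[of x] by (simp add: walk_avg_def lazy_avg_def add.commute)
qed (simp add: indicator_def)

lemma avg_measurable [measurable]:
  assumes [measurable]: "f \<in> borel_measurable borel"
  shows "walk_avg f \<in> borel_measurable borel" "lazy_avg e f \<in> borel_measurable borel"
  unfolding walk_avg_def lazy_avg_def by measurable

lemma hit_value_measurable [measurable]: "hit_value e k \<in> borel_measurable borel"
  by (induction k) simp_all

section \<open>Multiscale lower bound for the value function\<close>

text \<open>Laziness makes \<open>x\<^sup>2\<close> grow by only \<open>e\<close> per step in the mean.\<close>
lemma hit_value_stay:
  assumes e: "0 \<le> e" "e \<le> 1" and b: "0 < b" and m: "0 \<le> m"
    and start: "\<And>x. x \<in> \<int> \<Longrightarrow> \<bar>x\<bar> \<le> b \<Longrightarrow> m \<le> hit_value e k x"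
  shows "x \<in> \<int> \<Longrightarrow> m * (1 - (x\<^sup>2 + e * real s) / b\<^sup>2) \<le> hit_value e (k + s) x"
proof (induction s arbitrary: x)
  case 0
  show ?case
  \<comment> \<open>The quadratic is at most \<open>m\<close> on the interval of radius
    \<open>b\<close> and nonpositive off it.\<close>
  proof (cases "\<bar>x\<bar> \<le> b")
    case True
    have "m * (1 - x\<^sup>2 / b\<^sup>2) \<le> m * 1" using m by (intro mult_left_mono) auto
    with start[OF 0 True] show ?thesis by simp
  next
    case False
    then have "b\<^sup>2 \<le> x\<^sup>2" using b by (intro abs_le_square_iff[THEN iffD1]) auto
    then have "1 \<le> x\<^sup>2 / b\<^sup>2" using b by simp
    then have "m * (1 - x\<^sup>2 / b\<^sup>2) \<le> 0" using m by (simp add: mult_nonneg_nonpos)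
    with hit_value_ge_0[of e k x] show ?thesis by simp
  qed
next
  case (Suc s)
  \<comment> \<open>One lazy step preserves the minorant exactly, and \<open>hit_value\<close>
    dominates a lazy step because it is a maximum.\<close>
  have "m * (1 - (x\<^sup>2 + e * real (Suc s)) / b\<^sup>2)
      = lazy_avg e (\<lambda>x. m * (1 - (x\<^sup>2 + e * real s) / b\<^sup>2)) x"
    using b by (simp add: lazy_avg_def walk_avg_def field_simps power2_eq_square)
  also have "\<dots> \<le> lazy_avg e (hit_value e (k + s)) x"
    using Suc.prems by (intro lazy_avg_mono e Suc.IH) auto
  finally show ?case by simp
qed

text \<open>The subtracted terms bound the probability that the simple random walk leaves \<open>{0..L}\<close>
  at \<open>L\<close>, and, by Markov's inequality, the probability that it stays inside for \<open>S\<close> steps.\<close>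
lemma hit_value_return:
  assumes m: "0 \<le> m" and L: "0 < L" and S: "0 < S"
    and zero: "\<And>s. s \<le> S \<Longrightarrow> m \<le> hit_value e (k + s) 0"
  shows "s \<le> S \<Longrightarrow> i \<le> L \<Longrightarrow>
    m * (real s / real S - real i / real L - real i * (real L - real i) / real S)
      \<le> hit_value e (k + s) (real i)"
proof (induction s arbitrary: i)
  case 0
  \<comment> \<open>When time has run out the minorant must be nonpositive; hence the leading term
    \<open>s / S\<close> in place of \<open>1\<close>.\<close>
  have "0 \<le> real i / real L + real i * (real L - real i) / real S" using 0 by simp
  then have "m * (real (0::nat) / real S - real i / real L - real i * (real L - real i) / real S) \<le> 0"
    using m by (intro mult_nonneg_nonpos) simp_all
  with hit_value_ge_0[of e k "real i"] show ?case by simp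
next
  case (Suc s)
  have s1: "real (Suc s) / real S \<le> 1" using Suc.prems S by simp
  \<comment> \<open>At \<open>0\<close> the hypothesis \<open>zero\<close> takes over; reaching
    \<open>L\<close> counts as failure, since the minorant is nonpositive there.\<close>
  consider "i = 0" | "i = L" | j where "i = Suc j" "i < L"
    using Suc.prems(2) by (cases i) (auto simp: le_less)
  then show ?case
  proof cases
    case 1
    have "m * (real (Suc s) / real S) \<le> m * 1" by (rule mult_left_mono[OF s1 m])
    with zero[OF Suc.prems(1)] 1 show ?thesis by simp
  next
    case 2
    have "m * (real (Suc s) / real S - 1) \<le> 0" using s1 m by (intro mult_nonneg_nonpos) simp_all
    with 2 L hit_value_ge_0[of e "k + Suc s" "real i"] show ?thesis by simp
  next
    case 3
    \<comment> \<open>\<open>y * (L - y)\<close> is the mean exit time of the simple walk from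
      \<open>{0..L}\<close>. It drops by 1 on average per step, which pays for raising
      \<open>s\<close> to \<open>Suc s\<close>; the term \<open>y / L\<close> is harmonic.\<close>
    define g where "g y = m * (real s / real S - y / real L - y * (real L - y) / real S)" for y
    have "m * (real (Suc s) / real S - real i / real L - real i * (real L - real i) / real S)
        = walk_avg g (real i)"
      using L S by (simp add: g_def walk_avg_def field_simps)
    also have "\<dots> \<le> walk_avg (hit_value e (k + s)) (real i)"
    proof (rule walk_avg_mono)
      show "g (real i + 1) \<le> hit_value e (k + s) (real i + 1)"
        using Suc.IH[of "Suc i"] Suc.prems 3 by (simp add: g_def add.commute)
      show "g (real i - 1) \<le> hit_value e (k + s) (real i - 1)"
        using Suc.IH[of j] Suc.prems 3 by (simp add: g_def)
    qed
    finally show ?thesis by simp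
  qed
qed

text \<open>With \<open>e * S = 4 ^ j / D\<close>, lazy waiting at \<open>0\<close> loses a fraction
  \<open>1 / D\<close>, at every scale with the same \<open>e\<close>. It is bounded for all
  \<open>s \<le> S\<close> because the time left on reaching \<open>0\<close> is random. The return
  to \<open>0\<close> loses a further \<open>2 / D\<close> for escaping and \<open>2 / D\<close> for
  being late.\<close>

lemma hit_value_scale:
  fixes D j :: nat
  defines "e \<equiv> 1 / real D ^ 3" and "S \<equiv> D\<^sup>2 * 4 ^ j"
  assumes D: "5 \<le> D" and m: "0 \<le> m"
    and start: "\<And>x. x \<in> \<int> \<Longrightarrow> \<bar>x\<bar> \<le> 2 ^ j \<Longrightarrow> m \<le> hit_value e k x"
  shows "s \<le> S \<Longrightarrow> m * (1 - 1 / real D) \<le> hit_value e (k + s) 0"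
    and "x \<in> \<int> \<Longrightarrow> \<bar>x\<bar> \<le> 2 ^ Suc j \<Longrightarrow> m * (1 - 5 / real D) \<le> hit_value e (k + S) x"
proof -
  have e: "0 \<le> e" "e \<le> 1" using D by (auto simp: e_def)
  have pow: "(2 ^ j)\<^sup>2 = (4::real) ^ j" by (simp add: power2_eq_square flip: power_mult_distrib)
  show stay: "m * (1 - 1 / real D) \<le> hit_value e (k + s) 0" if "s \<le> S" for s
  proof -
    have "e * real s \<le> e * real S" using e that by (intro mult_left_mono) auto
    also have "\<dots> = 4 ^ j / real D"
      using D by (simp add: e_def S_def field_simps power2_eq_square power3_eq_cube)
    finally have "(0\<^sup>2 + e * real s) / (2 ^ j)\<^sup>2 \<le> 1 / real D"
      unfolding pow by (simp add: field_simps)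
    then have "m * (1 - 1 / real D) \<le> m * (1 - (0\<^sup>2 + e * real s) / (2 ^ j)\<^sup>2)"
      using m by (intro mult_left_mono) auto
    also have "\<dots> \<le> hit_value e (k + s) 0"
      by (rule hit_value_stay[OF e _ m start]) auto
    finally show ?thesis .
  qed
  show "m * (1 - 5 / real D) \<le> hit_value e (k + S) x" if x: "x \<in> \<int>" "\<bar>x\<bar> \<le> 2 ^ Suc j"
  proof -
    define i where "i = nat \<bar>\<lfloor>x\<rfloor>\<bar>"
    have i: "real i = \<bar>x\<bar>" using x(1) by (auto simp: i_def elim!: Ints_cases)
    \<comment> \<open>From \<open>i \<le> 2 * 2 ^ j\<close> the escape probability is at most
      \<open>2 / D\<close>, and the mean exit time is at most
      \<open>2 * 2 ^ j * L = (2 / D) * S\<close>.\<close>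
    define L where "L = D * 2 ^ j"
    have L: "0 < L" "i \<le> L" and S: "0 < S"
    proof -
      have "real i \<le> real (2 * 2 ^ j)" using i x(2) by simp
      then have "i \<le> 2 * 2 ^ j" by (simp only: of_nat_le_iff)
      also have "\<dots> \<le> D * 2 ^ j" using D by (intro mult_right_mono) auto
      finally show "i \<le> L" by (simp add: L_def)
    qed (use D in \<open>auto simp: L_def S_def\<close>)
    have 1: "real i / real L \<le> 2 / real D"
      using i x(2) D by (simp add: L_def field_simps)
    have "real i * (real L - real i) / real S \<le> (2 * 2 ^ j) * real L / real S"
      using i x(2) L by (intro divide_right_mono mult_mono) auto
    also have "\<dots> = 2 / real D"
      using D by (simp add: L_def S_def field_simps power2_eq_square flip: pow)
    finally have 2: "real i * (real L - real i) / real S \<le> 2 / real D" .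
    have "1 - 5 / real D \<le> (1 - 1 / real D) * (1 - 4 / real D)"
      using D by (simp add: field_simps)
    then have "m * (1 - 5 / real D) \<le> m * ((1 - 1 / real D) * (1 - 4 / real D))"
      by (rule mult_left_mono[OF _ m])
    also have "\<dots> \<le> m * (1 - 1 / real D) *
        (real S / real S - real i / real L - real i * (real L - real i) / real S)"
      unfolding mult.assoc 
    proof (intro mult_left_mono)
      show "1 - 4 / real D
          \<le> real S / real S - real i / real L - real i * (real L - real i) / real S"
        using 1 2 S by simp
    qed (use D m in auto)
    also have "\<dots> \<le> hit_value e (k + S) (real i)"
      by (rule hit_value_return[OF _ L(1) S stay order_refl L(2)]) (use D m in auto)
    also have "\<dots> = hit_value e (k + S) x"
      using i hit_value_uminus[of e "k + S" x] by (cases "0 \<le> x") auto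
    finally show ?thesis .
  qed
qed

text \<open>The constant 16 is 4 times 4: one factor comes from \<open>4 ^ j \<le> 4 * n\<close>,
  the other from the steps left over after the last complete scale.\<close>

lemma hit_value_origin:
  fixes D n :: nat
  assumes D: "5 \<le> D" and \<alpha>: "0 < \<alpha>" "4 powr (- \<alpha>) \<le> 1 - 5 / real D" and n: "0 < n"
  shows "16 powr (- \<alpha>) * real n powr (- \<alpha>) \<le> hit_value (1 / real D ^ 3) n 0"
proof -
  define e q where "e = 1 / real D ^ 3" and "q = 1 - 5 / real D"
  \<comment> \<open>The time used up by the \<open>j\<close> smallest scales.\<close>
  define t where "t j = (\<Sum>i<j. D\<^sup>2 * 4 ^ i)" for j
  have q: "0 \<le> q" "q \<le> 1 - 1 / real D" using D by (auto simp: q_def field_simps)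
  have scale: "q ^ j \<le> hit_value e (t j) x" if "x \<in> \<int>" "\<bar>x\<bar> \<le> 2 ^ j" for j x
    using that
  proof (induction j arbitrary: x)
    case 0
    then show ?case by (simp add: t_def)
  next
    case (Suc j)
    from hit_value_scale(2)[OF D _ Suc.IH[unfolded e_def] Suc.prems] q(1)
    show ?case by (simp add: t_def e_def q_def mult.commute)
  qed
  have t_ge: "4 ^ j \<le> 3 * t j + 1" for j
  proof (induction j)
    case (Suc j)
    have "1 * 4 ^ j \<le> D\<^sup>2 * 4 ^ j" using D by (intro mult_right_mono) auto
    moreover have "t (Suc j) = t j + D\<^sup>2 * 4 ^ j" by (simp add: t_def)
    ultimately show ?case using Suc unfolding power_Suc by linarith
  qed simp
  \<comment> \<open>The largest number of complete scales that fit into \<open>n\<close> steps;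
    \<open>bound\<close> makes the maximum exist.\<close>
  define j where "j = (GREATEST j. t j \<le> n)"
  have bound: "i \<le> n" if "t i \<le> n" for i
  proof -
    have "i \<le> t i"
    proof (induction i)
      case (Suc i)
      have "0 < D\<^sup>2 * 4 ^ i" using D by simp
      with Suc show ?case unfolding t_def sum.lessThan_Suc by linarith
    qed simp
    with that show ?thesis by simp
  qed
  have "t 0 \<le> n" by (simp add: t_def)
  then have tj: "t j \<le> n"
    unfolding j_def by (rule GreatestI_nat[of "\<lambda>j. t j \<le> n"]) (rule bound)
  have "\<not> t (Suc j) \<le> n"
  proof
    assume "t (Suc j) \<le> n"
    then have "Suc j \<le> (GREATEST j. t j \<le> n)"
      by (rule Greatest_le_nat[of "\<lambda>j. t j \<le> n"]) (rule bound)
    then show False by (simp flip: j_def)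
  qed
  \<comment> \<open>The leftover time is at most the length of scale \<open>j\<close>. It is spent
    first, waiting lazily at the starting point \<open>0\<close>.\<close>
  then have s: "n - t j \<le> D\<^sup>2 * 4 ^ j" by (simp add: t_def)
  have "4 ^ j \<le> 4 * n" using t_ge[of j] tj n by simp
  then have "real (4 ^ j) \<le> real (4 * n)" by (simp only: of_nat_le_iff)
  then have "(4 * real n) powr (- \<alpha>) \<le> (4 ^ j) powr (- \<alpha>)"
    using \<alpha>(1) by (intro powr_mono2') auto
  also have "\<dots> = (4 powr real j) powr (- \<alpha>)" by (simp add: powr_realpow)
  also have "\<dots> = (4 powr (- \<alpha>)) powr real j" by (simp add: powr_powr mult.commute)
  also have "\<dots> = (4 powr (- \<alpha>)) ^ j" by (simp add: powr_realpow)
  also have "\<dots> \<le> q ^ j" using \<alpha>(2) by (intro power_mono) (auto simp: q_def)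
  finally have "4 powr (- \<alpha>) * (4 * real n) powr (- \<alpha>) \<le> q * q ^ j"
    using \<alpha>(2) q by (intro mult_mono) (auto simp: q_def)
  also have "q * q ^ j \<le> q ^ j * (1 - 1 / real D)"
    using q by (subst mult.commute) (intro mult_left_mono, auto)
  also have "\<dots> \<le> hit_value e (t j + (n - t j)) 0"
    unfolding e_def by (rule hit_value_scale(1)[OF D _ scale[unfolded e_def] s]) (use q in auto)
  finally have "4 powr (- \<alpha>) * (4 * real n) powr (- \<alpha>) \<le> hit_value e n 0"
    using tj by simp
  moreover have "(16::real) powr (- \<alpha>) = 4 powr (- \<alpha>) * 4 powr (- \<alpha>)"
    by (subst powr_mult[symmetric]) simp_all
  ultimately show ?thesis by (simp add: e_def powr_mult)
qed

section \<open>Conditioning on the past in an infinite product space\<close>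

context sequence_space
begin

text \<open>Coordinate \<open>i\<close> is left out, so that the noise of the step from time
  \<open>i\<close> to \<open>Suc i\<close> is independent of \<open>past i\<close>. Pulling back to
  \<open>space S\<close> makes all these sigma-algebras live on one space.\<close>

definition past :: "nat \<Rightarrow> (nat \<Rightarrow> 'a) measure" where
  "past i = vimage_algebra (space S) (\<lambda>\<omega>. restrict \<omega> {..<i}) (\<Pi>\<^sub>M j\<in>{..<i}. M)"

lemma space_past [simp]: "space (past i) = space S"
  by (simp add: past_def)

lemma coordinate_measurable_past:
  assumes "j < i"
  shows "(\<lambda>\<omega>. \<omega> j) \<in> measurable (past i) M"
proof -
  have "(\<lambda>\<omega>. restrict \<omega> {..<i}) \<in> measurable (past i) (\<Pi>\<^sub>M j\<in>{..<i}. M)"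
    unfolding past_def by (rule measurable_vimage_algebra1) (auto simp: space_PiM split: if_splits)
  from measurable_compose[OF this measurable_component_singleton[of j]] assms
  show ?thesis by simp
qed

lemma measurable_into_past:
  assumes "f \<in> space N \<rightarrow> space S" "\<And>j. j < i \<Longrightarrow> (\<lambda>\<omega>. f \<omega> j) \<in> measurable N M"
  shows "f \<in> measurable N (past i)"
  unfolding past_def
  using assms by (intro measurable_vimage_algebra2 measurable_restrict) auto

lemma sets_past_mono:
  assumes "i \<le> j"
  shows "sets (past i) \<subseteq> sets (past j)"
proof
  fix A assume A: "A \<in> sets (past i)"
  have "(\<lambda>\<omega>. \<omega>) \<in> measurable (past j) (past i)"
    using assms by (intro measurable_into_past coordinate_measurable_past) auto
  from measurable_sets[OF this A] sets.sets_into_space[OF A]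
  show "A \<in> sets (past j)" by (simp add: Int_absorb2)
qed

lemma subalgebra_past: "subalgebra S (past i)"
proof -
  have "(\<lambda>\<omega>. \<omega>) \<in> measurable S (past i)"
    by (intro measurable_into_past) auto
  from measurable_sets[OF this] have "sets (past i) \<subseteq> sets S"
    using sets.sets_into_space[of _ "past i"] by (auto simp: Int_absorb2)
  then show ?thesis by (simp add: subalgebra_def)
qed

text \<open>\<open>comb_seq i\<close> keeps the first \<open>i\<close> coordinates of its first
  argument, and events of the past see nothing else.\<close>

lemma comb_seq_mem_past_iff:
  assumes A: "A \<in> sets (past i)" and \<omega>: "\<omega> \<in> space S" "\<omega>' \<in> space S"
  shows "comb_seq i \<omega> \<omega>' \<in> A \<longleftrightarrow> \<omega> \<in> A"
proof -
  obtain B where B: "A = (\<lambda>\<omega>. restrict \<omega> {..<i}) -` B \<inter> space S"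
    using A unfolding past_def by (subst (asm) sets_vimage_algebra2) (auto simp: space_PiM split: if_splits)
  have "restrict (comb_seq i \<omega> \<omega>') {..<i} = restrict \<omega> {..<i}"
    by (auto simp: comb_seq_def)
  moreover have "comb_seq i \<omega> \<omega>' \<in> space S"
    using \<omega> by (auto simp: space_PiM PiE_iff comb_seq_def)
  ultimately show ?thesis using \<omega> by (simp add: B)
qed

lemma comb_seq_measurable_past:
  fixes X :: "(nat \<Rightarrow> 'a) \<Rightarrow> real"
  assumes X: "X \<in> borel_measurable (past i)" and \<omega>: "\<omega> \<in> space S" "\<omega>' \<in> space S"
  shows "X (comb_seq i \<omega> \<omega>') = X \<omega>"
proof -
  \<comment> \<open>The level set of \<open>X\<close> through \<open>\<omega>\<close> is an event of
    the past.\<close>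
  have "X -` {X \<omega>} \<inter> space (past i) \<in> sets (past i)"
    by (rule measurable_sets[OF X]) simp
  from comb_seq_mem_past_iff[OF this \<omega>] \<omega> show ?thesis by simp
qed

text \<open>Resampling the coordinates from \<open>i\<close> on preserves the product measure, so conditioning on the
  past reduces to Fubini's theorem.\<close>
lemma real_cond_exp_past:
  fixes X :: "(nat \<Rightarrow> 'a) \<Rightarrow> real" and \<psi> :: "real \<Rightarrow> 'a \<Rightarrow> real"
  assumes X: "X \<in> borel_measurable (past i)"
    and \<psi> [measurable]: "case_prod \<psi> \<in> borel_measurable (borel \<Otimes>\<^sub>M M)"
    and int: "integrable S (\<lambda>\<omega>. \<psi> (X \<omega>) (\<omega> i))"
  shows "AE \<omega> in S. real_cond_exp S (past i) (\<lambda>\<omega>. \<psi> (X \<omega>) (\<omega> i)) \<omega> = (\<integral>y. \<psi> (X \<omega>) y \<partial>M)"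
proof -
  interpret sigma_finite_subalgebra S "past i"
    by (rule finite_measure_subalgebra_is_sigma_finite)
      (unfold_locales, rule subalgebra_past)
  interpret SS: pair_prob_space S S ..
  have [measurable]: "X \<in> borel_measurable S"
    by (rule measurable_from_subalg[OF subalgebra_past X])
  have comb [measurable]: "(\<lambda>(\<omega>, \<omega>'). comb_seq i \<omega> \<omega>') \<in> measurable (S \<Otimes>\<^sub>M S) S"
    by (rule measurable_comb_seq)
  have marginal: "(\<integral>\<omega>'. \<psi> x (\<omega>' 0) \<partial>S) = (\<integral>y. \<psi> x y \<partial>M)" for x
  proof -
    have "(\<integral>y. \<psi> x y \<partial>distr S M (\<lambda>\<omega>'. \<omega>' 0)) = (\<integral>\<omega>'. \<psi> x (\<omega>' 0) \<partial>S)"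
      by (rule integral_distr) measurable
    then show ?thesis by (simp add: PiM_component)
  qed
  have split: "integrable S (\<lambda>\<omega>. indicator A \<omega> * (\<integral>y. \<psi> (X \<omega>) y \<partial>M))"
    "(\<integral>\<omega>. indicator A \<omega> * \<psi> (X \<omega>) (\<omega> i) \<partial>S)
      = (\<integral>\<omega>. indicator A \<omega> * (\<integral>y. \<psi> (X \<omega>) y \<partial>M) \<partial>S)"
    if A: "A \<in> sets (past i)" for A
  proof -
    have [measurable]: "A \<in> sets S" using A subalgebra_past by (auto simp: subalgebra_def)
    define f where "f \<omega> = indicator A \<omega> * \<psi> (X \<omega>) (\<omega> i)" for \<omega>
    have [measurable]: "f \<in> borel_measurable S" unfolding f_def by measurable
    have "integrable S f"
      unfolding f_def using integrable_mult_indicator[OF \<open>A \<in> sets S\<close> int] by simp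
    then have int2: "integrable (S \<Otimes>\<^sub>M S) (\<lambda>(\<omega>, \<omega>'). f (comb_seq i \<omega> \<omega>'))"
      by (subst (asm) PiM_comb_seq[of i, symmetric], subst (asm) integrable_distr_eq)
        (auto simp: case_prod_beta')
    \<comment> \<open>With \<open>\<omega>\<close> fixed, \<open>A\<close> and \<open>X\<close> are
      frozen, and coordinate \<open>i\<close> of the spliced sequence is coordinate \<open>0\<close>
      of the fresh one.\<close>
    have inner: "(\<integral>\<omega>'. f (comb_seq i \<omega> \<omega>') \<partial>S) = indicator A \<omega> * (\<integral>y. \<psi> (X \<omega>) y \<partial>M)"
      if \<omega>: "\<omega> \<in> space S" for \<omega>
    proof -
      have "(\<integral>\<omega>'. f (comb_seq i \<omega> \<omega>') \<partial>S) = (\<integral>\<omega>'. indicator A \<omega> * \<psi> (X \<omega>) (\<omega>' 0) \<partial>S)"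
      proof (rule Bochner_Integration.integral_cong[OF refl])
        fix \<omega>' assume \<omega>': "\<omega>' \<in> space S"
        show "f (comb_seq i \<omega> \<omega>') = indicator A \<omega> * \<psi> (X \<omega>) (\<omega>' 0)"
          using comb_seq_mem_past_iff[OF A \<omega> \<omega>'] comb_seq_measurable_past[OF X \<omega> \<omega>']
            comb_seq_add[of i \<omega> \<omega>' 0]
          by (simp add: f_def indicator_def)
      qed
      then show ?thesis by (simp add: marginal)
    qed
    have "integrable S (\<lambda>\<omega>. \<integral>\<omega>'. f (comb_seq i \<omega> \<omega>') \<partial>S)"
      using SS.integrable_fst'[OF int2] by simp
    also have "?this \<longleftrightarrow> integrable S (\<lambda>\<omega>. indicator A \<omega> * (\<integral>y. \<psi> (X \<omega>) y \<partial>M))"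
      by (rule Bochner_Integration.integrable_cong[OF refl inner])
    finally show "integrable S (\<lambda>\<omega>. indicator A \<omega> * (\<integral>y. \<psi> (X \<omega>) y \<partial>M))" .
    have "(\<integral>\<omega>. f \<omega> \<partial>S) = (\<integral>\<omega>. f \<omega> \<partial>distr (S \<Otimes>\<^sub>M S) S (\<lambda>(\<omega>, \<omega>'). comb_seq i \<omega> \<omega>'))"
      by (simp add: PiM_comb_seq)
    also have "\<dots> = (\<integral>p. (case p of (\<omega>, \<omega>') \<Rightarrow> f (comb_seq i \<omega> \<omega>')) \<partial>(S \<Otimes>\<^sub>M S))"
      by (subst integral_distr) (auto simp: case_prod_beta')
    also have "\<dots> = (\<integral>\<omega>. \<integral>\<omega>'. f (comb_seq i \<omega> \<omega>') \<partial>S \<partial>S)"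
      using SS.integral_fst'[OF int2] by simp
    also have "\<dots> = (\<integral>\<omega>. indicator A \<omega> * (\<integral>y. \<psi> (X \<omega>) y \<partial>M) \<partial>S)"
      by (rule Bochner_Integration.integral_cong) (auto simp: inner)
    finally show "(\<integral>\<omega>. indicator A \<omega> * \<psi> (X \<omega>) (\<omega> i) \<partial>S)
      = (\<integral>\<omega>. indicator A \<omega> * (\<integral>y. \<psi> (X \<omega>) y \<partial>M) \<partial>S)"
      by (simp add: f_def)
  qed
  show ?thesis
  proof (rule real_cond_exp_charact[OF _ int])
    show "(\<integral>\<omega>\<in>A. \<psi> (X \<omega>) (\<omega> i) \<partial>S) = (\<integral>\<omega>\<in>A. (\<integral>y. \<psi> (X \<omega>) y \<partial>M) \<partial>S)"
      if "A \<in> sets (past i)" for A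
      using split(2)[OF that] by (simp add: set_lebesgue_integral_def)
    \<comment> \<open>Testing against the whole space yields integrability of the candidate.\<close>
    have "space S \<in> sets (past i)" using sets.top[of "past i"] by simp
    from split(1)[OF this]
    have "integrable S (\<lambda>\<omega>. indicator (space S) \<omega> * (\<integral>y. \<psi> (X \<omega>) y \<partial>M))" .
    also have "?this \<longleftrightarrow> integrable S (\<lambda>\<omega>. \<integral>y. \<psi> (X \<omega>) y \<partial>M)"
      by (rule Bochner_Integration.integrable_cong) auto
    finally show "integrable S (\<lambda>\<omega>. \<integral>y. \<psi> (X \<omega>) y \<partial>M)" .
    have "(\<lambda>x. \<integral>y. \<psi> x y \<partial>M) \<in> borel_measurable borel"
      by (rule M.borel_measurable_lebesgue_integral) measurable
    from measurable_compose[OF X this]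
    show "(\<lambda>\<omega>. \<integral>y. \<psi> (X \<omega>) y \<partial>M) \<in> borel_measurable (past i)" .
  qed
qed

end

section \<open>The optimally controlled walk\<close>

text \<open>The sign of the noise is the direction of the step; a lazy step is carried out only if the
  noise has modulus \<open>2\<close>.\<close>
definition step_noise :: "real \<Rightarrow> real measure" where
  "step_noise e = distr (measure_pmf (pair_pmf (bernoulli_pmf (1/2)) (bernoulli_pmf e))) borel
     (\<lambda>(u, h). (if u then 1 else - 1) * (if h then 2 else 1))"

lemma sets_step_noise [simp, measurable_cong]: "sets (step_noise e) = sets borel"
  by (simp add: step_noise_def)

lemma prob_space_step_noise: "prob_space (step_noise e)"
  unfolding step_noise_def by (intro prob_space.prob_space_distr prob_space_measure_pmf) simp

lemma integral_step_noise:
  fixes f :: "real \<Rightarrow> real"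
  assumes [measurable]: "f \<in> borel_measurable borel" and e: "0 \<le> e" "e \<le> 1"
  shows "(\<integral>y. f y \<partial>step_noise e)
    = (1 - e) * ((f 1 + f (- 1)) / 2) + e * ((f 2 + f (- 2)) / 2)"
proof -
  have "(\<integral>y. f y \<partial>step_noise e)
    = (\<integral>p. f (case p of (u, h) \<Rightarrow> (if u then 1 else - 1) * (if h then 2 else 1))
        \<partial>measure_pmf (pair_pmf (bernoulli_pmf (1/2)) (bernoulli_pmf e)))"
    unfolding step_noise_def by (subst integral_distr) auto
  also have "\<dots> = (\<Sum>p\<in>UNIV. pmf (pair_pmf (bernoulli_pmf (1/2)) (bernoulli_pmf e)) p *
      f (case p of (u, h) \<Rightarrow> (if u then 1 else - 1) * (if h then 2 else 1)))"
    by (subst integral_measure_pmf[of UNIV]) auto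
  also have "\<dots> = (1 - e) * ((f 1 + f (- 1)) / 2) + e * ((f 2 + f (- 2)) / 2)"
    using e by (simp add: UNIV_Times_UNIV[symmetric] UNIV_bool pmf_pair field_simps
        del: UNIV_Times_UNIV)
  finally show ?thesis .
qed

text \<open>Here \<open>k\<close> is the number of steps left after this one. The test selects the
  average attaining the maximum in \<open>hit_value e (Suc k)\<close>, ties going to the simple
  step.\<close>

definition control_step :: "real \<Rightarrow> nat \<Rightarrow> real \<Rightarrow> real \<Rightarrow> real" where
  "control_step e k x y = x +
     (if lazy_avg e (hit_value e k) x \<le> walk_avg (hit_value e k) x \<or> \<bar>y\<bar> = 2 then sgn y else 0)"

text \<open>Truncated subtraction gives \<open>n - Suc i = 0\<close> from time \<open>n\<close> on,
  so the walk continues forever under the same rules, as the conditions at all times demand.\<close>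

primrec controlled_walk :: "real \<Rightarrow> nat \<Rightarrow> nat \<Rightarrow> (nat \<Rightarrow> real) \<Rightarrow> real" where
  "controlled_walk e n 0 \<omega> = 0"
| "controlled_walk e n (Suc i) \<omega>
    = control_step e (n - Suc i) (controlled_walk e n i \<omega>) (\<omega> i)"

lemma control_step_measurable [measurable]:
  "case_prod (control_step e k) \<in> borel_measurable (borel \<Otimes>\<^sub>M borel)"
  unfolding control_step_def by measurable

lemma abs_control_step_diff_le: "\<bar>control_step e k x y - x\<bar> \<le> 1"
  by (simp add: control_step_def sgn_if)

text \<open>The identity as \<open>f\<close> gives the martingale property;
  \<open>hit_value e k\<close> as \<open>f\<close> gives the recursion for the value.\<close>

lemma integral_control_step:
  fixes f :: "real \<Rightarrow> real"
  assumes [measurable]: "f \<in> borel_measurable borel" and e: "0 \<le> e" "e \<le> 1"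
  shows "(\<integral>y. f (control_step e k x y) \<partial>step_noise e) =
    (if lazy_avg e (hit_value e k) x \<le> walk_avg (hit_value e k) x
     then walk_avg f x else lazy_avg e f x)"
  by (subst integral_step_noise[OF _ e])
    (auto simp: control_step_def walk_avg_def lazy_avg_def field_simps)

context
  fixes e :: real and n :: nat
  assumes e: "0 < e" "e \<le> 1"
begin

interpretation N: prob_space "step_noise e" by (rule prob_space_step_noise)
interpretation sequence_space "step_noise e" ..

lemma controlled_walk_adapted: "controlled_walk e n i \<in> borel_measurable (past i)"
proof (induction i)
  case (Suc i)
  have "controlled_walk e n i \<in> borel_measurable (past (Suc i))"
    using Suc sets_past_mono[of i "Suc i"] unfolding measurable_def by auto
  moreover have "(\<lambda>\<omega>. \<omega> i) \<in> borel_measurable (past (Suc i))"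
    using coordinate_measurable_past[of i "Suc i"] by (simp cong: measurable_cong_sets)
  ultimately have "(\<lambda>\<omega>. (controlled_walk e n i \<omega>, \<omega> i)) \<in> measurable (past (Suc i)) (borel \<Otimes>\<^sub>M borel)"
    by (rule measurable_Pair)
  from measurable_compose[OF this control_step_measurable[of e "n - Suc i"]]
  show ?case by (simp add: controlled_walk.simps(2)[abs_def])
qed (simp add: controlled_walk.simps(1)[abs_def])

lemma controlled_walk_measurable [measurable]: "controlled_walk e n i \<in> borel_measurable S"
  by (rule measurable_from_subalg[OF subalgebra_past controlled_walk_adapted])

lemma abs_controlled_walk_le: "\<bar>controlled_walk e n i \<omega>\<bar> \<le> real i"
proof (induction i)
  case (Suc i)
  with abs_control_step_diff_le[of e "n - Suc i" "controlled_walk e n i \<omega>" "\<omega> i"]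
  show ?case by simp
qed simp

lemma integrable_controlled_walk: "integrable S (controlled_walk e n i)"
  by (rule P.integrable_const_bound[where B = "real i"]) (auto simp: abs_controlled_walk_le)

text \<open>Used with three choices of \<open>\<psi>\<close>: the next position, the indicator of a
  unit increment, and the value at the next position.\<close>

lemma cond_exp_controlled_walk:
  fixes \<psi> :: "real \<Rightarrow> real \<Rightarrow> real"
  assumes "case_prod \<psi> \<in> borel_measurable (borel \<Otimes>\<^sub>M borel)"
    and "integrable S (\<lambda>\<omega>. \<psi> (controlled_walk e n i \<omega>) (\<omega> i))"
  shows "AE \<omega> in S. real_cond_exp S (past i) (\<lambda>\<omega>. \<psi> (controlled_walk e n i \<omega>) (\<omega> i)) \<omega>
    = (\<integral>y. \<psi> (controlled_walk e n i \<omega>) y \<partial>step_noise e)"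
  using assms by (intro real_cond_exp_past controlled_walk_adapted)
    (simp_all cong: measurable_cong_sets sets_pair_measure_cong)

lemma martingale_controlled_walk: "martingale S past (controlled_walk e n)"
  unfolding martingale_def filtration_on_def
proof (intro conjI allI)
  show "filtration (space S) past"
    by unfold_locales (auto simp: sets_past_mono)
  show "AE \<omega> in S. real_cond_exp S (past i) (controlled_walk e n (Suc i)) \<omega>
      = controlled_walk e n i \<omega>" for i
  proof -
    have "(\<integral>y. control_step e (n - Suc i) x y \<partial>step_noise e) = x" for x
      using integral_control_step[of "\<lambda>x. x" e "n - Suc i" x] e
      by (simp add: walk_avg_def lazy_avg_def field_simps)
    then show ?thesis
      using cond_exp_controlled_walk[OF control_step_measurable[of e "n - Suc i"]]
        integrable_controlled_walk[of "Suc i"]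
      by (simp add: controlled_walk.simps(2)[abs_def])
  qed
qed (simp_all add: subalgebra_past controlled_walk_adapted integrable_controlled_walk)

text \<open>A simple step always has modulus 1 and a lazy one has it with probability
  \<open>e\<close>.\<close>

lemma cond_prob_unit_increment:
  "AE \<omega> in S. e \<le> cond_prob_given S (past i)
     {\<omega>' \<in> space S. \<bar>controlled_walk e n (Suc i) \<omega>' - controlled_walk e n i \<omega>'\<bar> = 1} \<omega>"
proof -
  define \<psi> :: "real \<Rightarrow> real \<Rightarrow> real" where
    "\<psi> x y = indicator {1} \<bar>control_step e (n - Suc i) x y - x\<bar>" for x y
  have meas [measurable]: "case_prod \<psi> \<in> borel_measurable (borel \<Otimes>\<^sub>M borel)"
    unfolding \<psi>_def by measurable
  have int: "integrable S (\<lambda>\<omega>. \<psi> (controlled_walk e n i \<omega>) (\<omega> i))"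
    by (rule P.integrable_const_bound[where B = 1]) (auto simp: \<psi>_def indicator_def)
  have ge: "e \<le> (\<integral>y. \<psi> x y \<partial>step_noise e)" for x
    using e by (subst integral_step_noise) (auto simp: \<psi>_def control_step_def)
  let ?A = "{\<omega> \<in> space S. \<bar>controlled_walk e n (Suc i) \<omega> - controlled_walk e n i \<omega>\<bar> = 1}"
  interpret sigma_finite_subalgebra S "past i"
    by (rule finite_measure_subalgebra_is_sigma_finite)
      (unfold_locales, rule subalgebra_past)
  have "AE \<omega> in S. real_cond_exp S (past i) (indicator ?A) \<omega>
      = real_cond_exp S (past i) (\<lambda>\<omega>. \<psi> (controlled_walk e n i \<omega>) (\<omega> i)) \<omega>"
    by (rule real_cond_exp_cong) (auto simp: \<psi>_def indicator_def)
  with cond_exp_controlled_walk[OF meas int] show ?thesis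
    unfolding cond_prob_given_def by eventually_elim (use ge in simp)
qed

text \<open>\<open>hit_value\<close> is harmonic along the walk, since the walk attains the maximum in its
  recursion.\<close>
lemma expectation_hit_value:
  "i \<le> n \<Longrightarrow> (\<integral>\<omega>. hit_value e (n - i) (controlled_walk e n i \<omega>) \<partial>S) = hit_value e n 0"
proof (induction i)
  case (Suc i)
  define k where "k = n - Suc i"
  have k: "n - i = Suc k" using Suc.prems by (simp add: k_def)
  define \<psi> where "\<psi> x y = hit_value e k (control_step e k x y)" for x y
  have meas [measurable]: "case_prod \<psi> \<in> borel_measurable (borel \<Otimes>\<^sub>M borel)"
    unfolding \<psi>_def by measurable
  have int: "integrable S (\<lambda>\<omega>. \<psi> (controlled_walk e n i \<omega>) (\<omega> i))"
    by (rule P.integrable_const_bound[where B = 1])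
      (use e in \<open>auto simp: \<psi>_def hit_value_ge_0 hit_value_le_1\<close>)
  have \<psi>: "(\<integral>y. \<psi> x y \<partial>step_noise e) = hit_value e (Suc k) x" for x
    unfolding \<psi>_def using e by (subst integral_control_step) auto
  interpret sigma_finite_subalgebra S "past i"
    by (rule finite_measure_subalgebra_is_sigma_finite)
      (unfold_locales, rule subalgebra_past)
  have "(\<integral>\<omega>. \<psi> (controlled_walk e n i \<omega>) (\<omega> i) \<partial>S)
      = (\<integral>\<omega>. real_cond_exp S (past i) (\<lambda>\<omega>. \<psi> (controlled_walk e n i \<omega>) (\<omega> i)) \<omega> \<partial>S)"
    by (rule real_cond_exp_int(2)[OF int, symmetric])
  also have "\<dots> = (\<integral>\<omega>. hit_value e (Suc k) (controlled_walk e n i \<omega>) \<partial>S)"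
    using cond_exp_controlled_walk[OF meas int] by (intro integral_cong_AE) (auto simp: \<psi>)
  also have "\<dots> = hit_value e n 0" using Suc k by simp
  finally show ?case by (simp add: \<psi>_def k_def)
qed (simp add: P.prob_space)

text \<open>At time \<open>n\<close> the value is the indicator of the target, so its expectation is
  the desired probability.\<close>

lemma prob_controlled_walk:
  "measure S {\<omega> \<in> space S. \<bar>controlled_walk e n n \<omega>\<bar> \<le> 1} = hit_value e n 0"
proof -
  let ?A = "{\<omega> \<in> space S. \<bar>controlled_walk e n n \<omega>\<bar> \<le> 1}"
  have "measure S ?A = (\<integral>\<omega>. indicator ?A \<omega> \<partial>S)"
    by simp
  also have "\<dots> = (\<integral>\<omega>. hit_value e (n - n) (controlled_walk e n n \<omega>) \<partial>S)"
    by (rule Bochner_Integration.integral_cong) (auto simp: indicator_def)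
  also have "\<dots> = hit_value e n 0" by (rule expectation_hit_value) simp
  finally show ?thesis .
qed

text \<open>The existential form hides \<open>S\<close> and \<open>past\<close>, which come from a
  local interpretation.\<close>

lemma controlled_walk_exists:
  "\<exists>(P :: (nat \<Rightarrow> real) measure) F M.
     prob_space P \<and> martingale P F M \<and>
     (\<forall>i. AE \<omega> in P. \<bar>M (Suc i) \<omega> - M i \<omega>\<bar> \<le> 1) \<and>
     (\<forall>i. AE \<omega> in P.
        e \<le> cond_prob_given P (F i) {\<omega>' \<in> space P. \<bar>M (Suc i) \<omega>' - M i \<omega>'\<bar> = 1} \<omega>) \<and>
     measure P {\<omega> \<in> space P. \<bar>M n \<omega>\<bar> \<le> 1} = hit_value e n 0"
  by (intro exI[of _ S] exI[of _ past] exI[of _ "controlled_walk e n"] conjI allI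
      martingale_controlled_walk cond_prob_unit_increment prob_controlled_walk AE_I2)
    (simp_all add: P.prob_space_axioms abs_control_step_diff_le)

end

section \<open>Choice of the constants\<close>

theorem corollary1:
  fixes \<alpha> :: real
  assumes "\<alpha> > 0"
  shows "\<exists>\<beta>>0. \<exists>c>0. \<forall>n::nat. n > 0 \<longrightarrow>
    (\<exists>(P :: (nat \<Rightarrow> real) measure) (F :: nat \<Rightarrow> (nat \<Rightarrow> real) measure)
       (M :: nat \<Rightarrow> (nat \<Rightarrow> real) \<Rightarrow> real).
       prob_space P \<and> martingale P F M \<and>
       (\<forall>i. AE \<omega> in P. \<bar>M (Suc i) \<omega> - M i \<omega>\<bar> \<le> 1) \<and>
       (\<forall>i. AE \<omega> in P.
          cond_prob_given P (F i) {\<omega>' \<in> space P. \<bar>M (Suc i) \<omega>' - M i \<omega>'\<bar> = 1} \<omega> > \<beta>) \<and>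
       measure P {\<omega> \<in> space P. \<bar>M n \<omega>\<bar> \<le> 1} \<ge> c * real n powr (- \<alpha>))"
proof -
  have lt: "4 powr (- \<alpha>) < (1::real)" using powr_less_mono[of "- \<alpha>" 0 4] assms by simp
  \<comment> \<open>This makes the loss per scale, \<open>5 / D\<close>, at most
    \<open>1 - 4 powr (- \<alpha>)\<close>.\<close>
  obtain D0 :: nat where D0: "5 / (1 - 4 powr (- \<alpha>)) \<le> real D0"
    using real_arch_simple by blast
  define D where "D = max 5 D0"
  define e where "e = 1 / real D ^ 3"
  have D: "5 \<le> D" by (simp add: D_def)
  have "5 / (1 - 4 powr (- \<alpha>)) \<le> real D" using D0 by (simp add: D_def)
  then have \<alpha>: "4 powr (- \<alpha>) \<le> 1 - 5 / real D" using lt D by (simp add: field_simps)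
  have e: "0 < e" "e \<le> 1" using D by (auto simp: e_def)
  show ?thesis
  \<comment> \<open>Halving \<open>e\<close> turns the weak bound on the conditional probability
    into a strict one.\<close>
  proof (rule exI[of _ "e / 2"], intro conjI exI[of _ "16 powr (- \<alpha>)"] allI impI)
    fix n :: nat assume n: "n > 0"
    obtain P :: "(nat \<Rightarrow> real) measure" and F M where
      PFM: "prob_space P" "martingale P F M" "\<forall>i. AE \<omega> in P. \<bar>M (Suc i) \<omega> - M i \<omega>\<bar> \<le> 1"
      and unit: "\<And>i. AE \<omega> in P.
        e \<le> cond_prob_given P (F i) {\<omega>' \<in> space P. \<bar>M (Suc i) \<omega>' - M i \<omega>'\<bar> = 1} \<omega>"
      and hit: "measure P {\<omega> \<in> space P. \<bar>M n \<omega>\<bar> \<le> 1} = hit_value e n 0"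
      using controlled_walk_exists[OF e, of n] by blast
    have "AE \<omega> in P. e / 2
        < cond_prob_given P (F i) {\<omega>' \<in> space P. \<bar>M (Suc i) \<omega>' - M i \<omega>'\<bar> = 1} \<omega>" for i
      using unit[of i] by eventually_elim (use e in simp)
    moreover have "16 powr (- \<alpha>) * real n powr (- \<alpha>)
        \<le> measure P {\<omega> \<in> space P. \<bar>M n \<omega>\<bar> \<le> 1}"
      unfolding hit e_def by (rule hit_value_origin[OF D assms \<alpha> n])
    ultimately show "\<exists>(P :: (nat \<Rightarrow> real) measure) (F :: nat \<Rightarrow> (nat \<Rightarrow> real) measure)
       (M :: nat \<Rightarrow> (nat \<Rightarrow> real) \<Rightarrow> real).
       prob_space P \<and> martingale P F M \<and>
       (\<forall>i. AE \<omega> in P. \<bar>M (Suc i) \<omega> - M i \<omega>\<bar> \<le> 1) \<and>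
       (\<forall>i. AE \<omega> in P.
          cond_prob_given P (F i) {\<omega>' \<in> space P. \<bar>M (Suc i) \<omega>' - M i \<omega>'\<bar> = 1} \<omega> > e / 2) \<and>
       measure P {\<omega> \<in> space P. \<bar>M n \<omega>\<bar> \<le> 1} \<ge> 16 powr (- \<alpha>) * real n powr (- \<alpha>)"
      using PFM by blast
  qed (use e in auto)
qed

end
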